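(* Let $(\Phi,\mathfrak N,\mathfrak T,\mathfrak R,\mathfrak S,\phi_{\mathrm{start}},\Sigma,\mathrm{Lex},\mathrm{Sel})$ be a parameterized local lexing and $D\in\Sigma^*$. Then $\mathcal J_0^0\sim\mathcal J'^{\,0}_0$, where $\mathcal J_0^0=\pi_0\,\emptyset\,\mathrm{Init}$ (PELLA) and $\mathcal J'^{\,0}_0=\pi'_0\,\emptyset\,\mathrm{Init}'$ (ELLA on the induced grammar).
   Context: $\Phi$ is a non-empty set; $\mathfrak N,\mathfrak T$ disjoint sets of nonterminals and terminals; $\mathfrak S\in\mathfrak N$, $\phi_{\mathrm{start}}\in\Phi$; $\mathfrak R$ a set of parameterized rules $N_{f_{k+1}}\to X_1^{f_1}\cdots X_k^{f_k}$ ($k\ge0$, $N\in\mathfrak N$, $X_i\in\mathfrak N\cup\mathfrak T$, partial $f_i:\Phi^{2i-1}\rightharpoonup\Phi$); $\Sigma$ a set of characters; $\mathrm{Lex},\mathrm{Sel}$ lexer and selector (not needed here). Sequences indexed from 0; juxtaposition is concatenation; $\mathrm{take}_n$ takes the first $n$ entries. $\langle f_1,\dots,f_u\rangle$ is the set of $\rho\in\Phi^{2u}$ with $f_i$ defined at $(\rho_0,\dots,\rho_{2i-2})$ and $\rho_{2i-1}=f_i(\rho_0,\dots,\rho_{2i-2})$ for $i=1,\dots,u$. Induced grammar: nonterminals $(\mathfrak N\times\Phi\times\Phi)\cup\{\top,\bot\}$, terminals $\mathfrak T\times\Phi\times\Phi$, triples written $X^\alpha_\beta$, start $\top$; rules $\overline{\mathfrak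 R}=\{\top\to\mathfrak S^{\phi_{\mathrm{start}}}_\beta\mid\beta\in\Phi\}\cup\bigcup_{r\in\mathfrak R}\overline r$, where for $r=N_{f_{k+1}}\to X_1^{f_1}\cdots X_k^{f_k}$, $\overline r$ consists of (i) rules $N^\alpha_\beta\to(X_1)^{\alpha_1}_{\beta_1}\cdots(X_k)^{\alpha_k}_{\beta_k}$ with $(\alpha,\alpha_1,\beta_1,\dots,\alpha_k,\beta_k,\beta)\in\langle f_1,\dots,f_{k+1}\rangle$, and (ii) rules $N^\alpha_\beta\to(X_1)^{\alpha_1}_{\beta_1}\cdots(X_h)^{\alpha_h}_{\beta_h}\bot$ with $1\le h\le k$, $\beta,\beta_h\in\Phi$, $(\alpha,\alpha_1,\beta_1,\dots,\alpha_h)\in\langle f_1,\dots,f_h\rangle$ and $f_{h+1}$ undefined at $(\alpha,\alpha_1,\beta_1,\dots,\alpha_h,\beta_h)$. Items: parameterized item $(r,d,i,j,\rho)$ with $r=N_{f_{v+1}}\to X_1^{f_1}\cdots X_v^{f_v}\in\mathfrak R$, $0\le d\le v$, $0\le i\le j\le|D|$, $\rho\in\langle f_1,\dots,f_{d+1}\rangle$. Ordinary item $(q,d,i,j)$ with $q=(L\to w)\in\overline{\mathfrak R}$, $0\le d\le|w|$, $0\le i\le j\le|D|$, written $(L\to w_1\bullet w_2,i,j)$, $|w_1|=d$. For $x=(r,d,i,j,\rho)$, $\overline x$ consists of all $(q,d,i,j)$ with $q\in\overline r$ of type (i) and $\mathrm{take}_{2(d+1)}(\alpha,\alpha_1,\beta_1,\dots,\alpha_k,\beta_k,\beta)=\rho$,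 and all $(q,d,i,j)$ with $q\in\overline r$ of type (ii), $d\le h-1$, $\mathrm{take}_{2(d+1)}(\alpha,\alpha_1,\beta_1,\dots,\alpha_h)=\rho$. $\overline I=\bigcup_{x\in I}\overline x$; $\mathrm{Norm}(I')=\{(L\to w_1\bullet w_2,i,j)\in I'\mid L\ne\top,\ w_2\text{ is not the one-symbol string }\bot\}$; $I\sim I'$ means $\overline I=\mathrm{Norm}(I')$. PELLA steps ($r=N_{f_{v+1}}\to X_1^{f_1}\cdots X_v^{f_v}$): $\mathrm{Init}=\{(r,0,0,0,(\phi_{\mathrm{start}},f_1(\phi_{\mathrm{start}})))\mid r\text{ has left side }\mathfrak S,\ f_1\text{ defined at }\phi_{\mathrm{start}}\}$; $\mathrm{Predict}\,k\,I=I\cup\{(r',0,k,k,(\rho_{2d+1},g_1(\rho_{2d+1})))\mid(r,d,i,k,\rho)\in I,d<v,X_{d+1}=M,\ r'=M_{g_{u+1}}\to Y_1^{g_1}\cdots Y_u^{g_u}\in\mathfrak R,\ g_1\text{ defined at }\rho_{2d+1}\}$; $\mathrm{Complete}\,k\,I=I\cup\{(r,d+1,i,k,\rho'\,f_{d+2}(\rho'))\mid(r,d,i,j,\rho)\in I,d<v,X_{d+1}=M,\ (r',u,j,k,\xi)\in I\text{ with }r'=M_{g_{u+1}}\to Y_1^{g_1}\cdots Y_u^{g_u},\ \rho_{2d+1}=\xi_0,\ \rho'=\rho\,\xi_{2u+1},\ f_{d+2}\text{ defined at }\rho'\}$; $\mathrm{Scan}\,T\,k\,I=I\cup\{(r,d+1,i,k+|c|,\rho'\,f_{d+2}(\rho'))\mid(r,d,i,k,\rho)\in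 I,d<v,(X_{d+1},\rho_{2d+1},\beta,c)\in T,\rho'=\rho\,\beta,f_{d+2}\text{ defined at }\rho'\}$. ELLA steps: $\mathrm{Init}'=\{(\top\to\bullet w,0,0)\mid(\top\to w)\in\overline{\mathfrak R}\}$; $\mathrm{Predict}'\,k\,I'=I'\cup\{(M\to\bullet w,k,k)\mid(L\to a\bullet M\,b,i,k)\in I',(M\to w)\in\overline{\mathfrak R}\}$; $\mathrm{Complete}'\,k\,I'=I'\cup\{(L\to a\,M\bullet b,i,k)\mid(L\to a\bullet M\,b,i,j)\in I',(M\to w\bullet,j,k)\in I'\}$; $\mathrm{Scan}'\,T'\,k\,I'=I'\cup\{(L\to a\,t\bullet b,i,k+|c|)\mid(L\to a\bullet t\,b,i,k)\in I',(t,c)\in T'\}$. With $\mathrm{limit}\,f\,X=\bigcup_{n\ge0}f^n(X)$: $\pi_k\,T\,I=\mathrm{limit}(\mathrm{Scan}\,T\,k\circ\mathrm{Complete}\,k\circ\mathrm{Predict}\,k)\,I$, $\pi'_k\,T'\,I'=\mathrm{limit}(\mathrm{Scan}'\,T'\,k\circ\mathrm{Complete}'\,k\circ\mathrm{Predict}'\,k)\,I'$. *)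

theory Defs
  imports Main
begin

section \<open>Parameterized local lexings\<close>

type_synonym 'f pfun = "'f list \<rightharpoonup> 'f"

definition pfuns :: "'f set \<Rightarrow> nat \<Rightarrow> 'f pfun set" where
  "pfuns \<Phi> n = {f. dom f \<subseteq> {xs. length xs = n \<and> set xs \<subseteq> \<Phi>} \<and> ran f \<subseteq> \<Phi>}"

text \<open>The rule \<open>N\<^bsub>f (k+1)\<^esub> \<rightarrow> X 1\<^bsup>f 1\<^esup> \<dots> X k\<^bsup>f k\<^esup>\<close> is
  \<open>PRule N [(X 1, f 1), \<dots>, (X k, f k)] (f (k+1))\<close>.\<close>

datatype ('s, 'f) prule =
  PRule (lhs: 's) (rhs: "('s \<times> 'f pfun) list") (final: "'f pfun")

text \<open>All positions are counted from 0 below: \<open>sym r d\<close> is \<open>X (d+1)\<close>, and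
  \<open>funs r ! d\<close> is \<open>f (d+1)\<close>.\<close>

definition arity :: "('s, 'f) prule \<Rightarrow> nat" where
  "arity r = length (rhs r)"

definition sym :: "('s, 'f) prule \<Rightarrow> nat \<Rightarrow> 's" where
  "sym r d = fst (rhs r ! d)"

definition funs :: "('s, 'f) prule \<Rightarrow> 'f pfun list" where
  "funs r = map snd (rhs r) @ [final r]"

text \<open>The lexer and the selector are arbitrary components of arbitrary type: nothing in this
  theory refers to them.\<close>

record ('f, 's, 'c, 'lex, 'sel) pll =
  params :: "'f set"
  nonterms :: "'s set"
  terms :: "'s set"
  prules :: "('s, 'f) prule set"
  pstart :: 's
  phi_start :: 'f
  chars :: "'c set"
  Lex :: 'lex
  Sel :: 'sel

definition wf_prule :: "('f, 's, 'c, 'lex, 'sel) pll \<Rightarrow> ('s, 'f) prule \<Rightarrow> bool" where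
  "wf_prule P r \<longleftrightarrow>
     lhs r \<in> nonterms P \<and>
     (\<forall>d < arity r. sym r d \<in> nonterms P \<union> terms P) \<and>
     (\<forall>d \<le> arity r. funs r ! d \<in> pfuns (params P) (2 * d + 1))"

definition parameterized_local_lexing :: "('f, 's, 'c, 'lex, 'sel) pll \<Rightarrow> bool" where
  "parameterized_local_lexing P \<longleftrightarrow>
     params P \<noteq> {} \<and>
     nonterms P \<inter> terms P = {} \<and>
     pstart P \<in> nonterms P \<and>
     phi_start P \<in> params P \<and>
     (\<forall>r \<in> prules P. wf_prule P r)"

text \<open>\<open>chain \<Phi> [f 1, \<dots>, f u]\<close> is \<open>\<langle>f 1, \<dots>, f u\<rangle>\<close>.\<close>

definition chain :: "'f set \<Rightarrow> 'f pfun list \<Rightarrow> 'f list set" where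
  "chain \<Phi> fs = {\<rho>. length \<rho> = 2 * length fs \<and> set \<rho> \<subseteq> \<Phi> \<and>
     (\<forall>i < length fs. (fs ! i) (take (2 * i + 1) \<rho>) = Some (\<rho> ! (2 * i + 1)))}"


section \<open>The induced grammar\<close>

record 'x cfg =
  cfg_nonterms :: "'x set"
  cfg_terms :: "'x set"
  cfg_rules :: "('x \<times> 'x list) set"
  cfg_start :: 'x

text \<open>\<open>Tri X \<alpha> \<beta>\<close> is \<open>X\<close> with superscript \<open>\<alpha>\<close> and subscript \<open>\<beta>\<close>.\<close>

datatype ('s, 'f) isym = Top | Bot | Tri 's 'f 'f

text \<open>For \<open>\<rho> = (\<alpha>, \<alpha> 1, \<beta> 1, \<dots>, \<alpha> h, \<beta> h, \<dots>)\<close>, \<open>body r \<rho> h\<close> is the string of the first \<open>h\<close>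
  symbols of the right side of \<open>r\<close>, the \<open>i\<close>-th of them with superscript \<open>\<alpha> i\<close> and
  subscript \<open>\<beta> i\<close>.\<close>

definition body :: "('s, 'f) prule \<Rightarrow> 'f list \<Rightarrow> nat \<Rightarrow> ('s, 'f) isym list" where
  "body r \<rho> h = map (\<lambda>d. Tri (sym r d) (\<rho> ! (2 * d + 1)) (\<rho> ! (2 * d + 2))) [0..<h]"

text \<open>\<open>rule_i P r \<rho> q\<close>: the rule \<open>q\<close> of type (i) of the induced grammar arises from
  the parameter sequence \<open>\<rho> = (\<alpha>, \<alpha> 1, \<beta> 1, \<dots>, \<alpha> k, \<beta> k, \<beta>)\<close>.\<close>

definition rule_i :: "('f, 's, 'c, 'lex, 'sel) pll \<Rightarrow> ('s, 'f) prule \<Rightarrow> 'f list \<Rightarrow>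
    ('s, 'f) isym \<times> ('s, 'f) isym list \<Rightarrow> bool" where
  "rule_i P r \<rho> q \<longleftrightarrow>
     \<rho> \<in> chain (params P) (funs r) \<and>
     q = (Tri (lhs r) (\<rho> ! 0) (\<rho> ! (2 * arity r + 1)), body r \<rho> (arity r))"

text \<open>\<open>rule_ii P r h \<sigma> q\<close>: the rule \<open>q\<close> of type (ii) of the induced grammar has \<open>h\<close>
  symbols before \<open>\<bottom>\<close> and arises from \<open>\<sigma> = (\<alpha>, \<alpha> 1, \<beta> 1, \<dots>, \<alpha> h)\<close>.\<close>

definition rule_ii :: "('f, 's, 'c, 'lex, 'sel) pll \<Rightarrow> ('s, 'f) prule \<Rightarrow> nat \<Rightarrow> 'f list \<Rightarrow>
    ('s, 'f) isym \<times> ('s, 'f) isym list \<Rightarrow> bool" where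
  "rule_ii P r h \<sigma> q \<longleftrightarrow>
     1 \<le> h \<and> h \<le> arity r \<and>
     \<sigma> \<in> chain (params P) (take h (funs r)) \<and>
     (\<exists>\<beta> \<in> params P. \<exists>\<beta>h \<in> params P.
        (funs r ! h) (\<sigma> @ [\<beta>h]) = None \<and>
        q = (Tri (lhs r) (\<sigma> ! 0) \<beta>, body r (\<sigma> @ [\<beta>h]) h @ [Bot]))"

definition rule_bar :: "('f, 's, 'c, 'lex, 'sel) pll \<Rightarrow> ('s, 'f) prule \<Rightarrow>
    (('s, 'f) isym \<times> ('s, 'f) isym list) set" where
  "rule_bar P r = {q. \<exists>\<rho>. rule_i P r \<rho> q} \<union> {q. \<exists>h \<sigma>. rule_ii P r h \<sigma> q}"

definition induced :: "('f, 's, 'c, 'lex, 'sel) pll \<Rightarrow> ('s, 'f) isym cfg" where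
  "induced P = \<lparr>
     cfg_nonterms = {Tri N \<alpha> \<beta> | N \<alpha> \<beta>. N \<in> nonterms P \<and> \<alpha> \<in> params P \<and> \<beta> \<in> params P} \<union> {Top, Bot},
     cfg_terms = {Tri t \<alpha> \<beta> | t \<alpha> \<beta>. t \<in> terms P \<and> \<alpha> \<in> params P \<and> \<beta> \<in> params P},
     cfg_rules = {(Top, [Tri (pstart P) (phi_start P) \<beta>]) | \<beta>. \<beta> \<in> params P} \<union>
       (\<Union>r \<in> prules P. rule_bar P r),
     cfg_start = Top \<rparr>"


section \<open>Items\<close>

type_synonym ('s, 'f) pitem = "('s, 'f) prule \<times> nat \<times> nat \<times> nat \<times> 'f list"
type_synonym 'x item = "('x \<times> 'x list) \<times> nat \<times> nat \<times> nat"

definition pitems :: "('f, 's, 'c, 'lex, 'sel) pll \<Rightarrow> 'c list \<Rightarrow> ('s, 'f) pitem set" where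
  "pitems P D = {(r, d, i, j, \<rho>). r \<in> prules P \<and> d \<le> arity r \<and> i \<le> j \<and> j \<le> length D \<and>
     \<rho> \<in> chain (params P) (take (d + 1) (funs r))}"

definition items :: "'x cfg \<Rightarrow> 'c list \<Rightarrow> 'x item set" where
  "items G D = {(q, d, i, j). q \<in> cfg_rules G \<and> d \<le> length (snd q) \<and> i \<le> j \<and> j \<le> length D}"

fun item_bar :: "('f, 's, 'c, 'lex, 'sel) pll \<Rightarrow> ('s, 'f) pitem \<Rightarrow> ('s, 'f) isym item set" where
  "item_bar P (r, d, i, j, \<rho>) =
     {(q, d, i, j) | q \<tau>. rule_i P r \<tau> q \<and> take (2 * (d + 1)) \<tau> = \<rho>} \<union>
     {(q, d, i, j) | q h \<sigma>. rule_ii P r h \<sigma> q \<and> d \<le> h - 1 \<and> take (2 * (d + 1)) \<sigma> = \<rho>}"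

definition items_bar :: "('f, 's, 'c, 'lex, 'sel) pll \<Rightarrow> ('s, 'f) pitem set \<Rightarrow>
    ('s, 'f) isym item set" where
  "items_bar P I = (\<Union>x \<in> I. item_bar P x)"

definition Norm :: "('s, 'f) isym item set \<Rightarrow> ('s, 'f) isym item set" where
  "Norm I' = {((L, w), d, i, j) | L w d i j. ((L, w), d, i, j) \<in> I' \<and> L \<noteq> Top \<and> drop d w \<noteq> [Bot]}"

text \<open>\<open>\<sim>\<close> relates sets of parameterized items to sets of ordinary items over the same input
  \<open>D\<close>. The first two conjuncts record this typing.\<close>

definition sim :: "('f, 's, 'c, 'lex, 'sel) pll \<Rightarrow> 'c list \<Rightarrow> ('s, 'f) pitem set \<Rightarrow>
    ('s, 'f) isym item set \<Rightarrow> bool" where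
  "sim P D I I' \<longleftrightarrow> I \<subseteq> pitems P D \<and> I' \<subseteq> items (induced P) D \<and> items_bar P I = Norm I'"


section \<open>Parsing steps\<close>

definition limit :: "('a set \<Rightarrow> 'a set) \<Rightarrow> 'a set \<Rightarrow> 'a set" where
  "limit f X = (\<Union>n. (f ^^ n) X)"

definition pella_Init :: "('f, 's, 'c, 'lex, 'sel) pll \<Rightarrow> ('s, 'f) pitem set" where
  "pella_Init P = {(r, 0, 0, 0, [phi_start P, a]) | r a.
     r \<in> prules P \<and> lhs r = pstart P \<and> (funs r ! 0) [phi_start P] = Some a}"

definition pella_Predict :: "('f, 's, 'c, 'lex, 'sel) pll \<Rightarrow> nat \<Rightarrow> ('s, 'f) pitem set \<Rightarrow>
    ('s, 'f) pitem set" where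
  "pella_Predict P k I = I \<union> {(r', 0, k, k, [\<rho> ! (2 * d + 1), a]) | r' a r d i \<rho>.
     (r, d, i, k, \<rho>) \<in> I \<and> d < arity r \<and> r' \<in> prules P \<and> lhs r' = sym r d \<and>
     (funs r' ! 0) [\<rho> ! (2 * d + 1)] = Some a}"

definition pella_Complete :: "('f, 's, 'c, 'lex, 'sel) pll \<Rightarrow> nat \<Rightarrow> ('s, 'f) pitem set \<Rightarrow>
    ('s, 'f) pitem set" where
  "pella_Complete P k I = I \<union> {(r, d + 1, i, k, \<rho>' @ [a]) | r d i j \<rho> r' \<xi> \<rho>' a.
     (r, d, i, j, \<rho>) \<in> I \<and> d < arity r \<and>
     (r', arity r', j, k, \<xi>) \<in> I \<and> lhs r' = sym r d \<and>
     \<rho> ! (2 * d + 1) = \<xi> ! 0 \<and>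
     \<rho>' = \<rho> @ [\<xi> ! (2 * arity r' + 1)] \<and>
     (funs r ! (d + 1)) \<rho>' = Some a}"

definition pella_Scan :: "('f, 's, 'c, 'lex, 'sel) pll \<Rightarrow> ('s \<times> 'f \<times> 'f \<times> 'c list) set \<Rightarrow> nat \<Rightarrow>
    ('s, 'f) pitem set \<Rightarrow> ('s, 'f) pitem set" where
  "pella_Scan P T k I = I \<union> {(r, d + 1, i, k + length c, \<rho>' @ [a]) | r d i \<rho> \<beta> c \<rho>' a.
     (r, d, i, k, \<rho>) \<in> I \<and> d < arity r \<and>
     (sym r d, \<rho> ! (2 * d + 1), \<beta>, c) \<in> T \<and>
     \<rho>' = \<rho> @ [\<beta>] \<and>
     (funs r ! (d + 1)) \<rho>' = Some a}"

definition pella_pi :: "('f, 's, 'c, 'lex, 'sel) pll \<Rightarrow> nat \<Rightarrow> ('s \<times> 'f \<times> 'f \<times> 'c list) set \<Rightarrow>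
    ('s, 'f) pitem set \<Rightarrow> ('s, 'f) pitem set" where
  "pella_pi P k T = limit (pella_Scan P T k \<circ> pella_Complete P k \<circ> pella_Predict P k)"

definition ella_Init :: "'x cfg \<Rightarrow> 'x item set" where
  "ella_Init G = {((cfg_start G, w), 0, 0, 0) | w. (cfg_start G, w) \<in> cfg_rules G}"

definition ella_Predict :: "'x cfg \<Rightarrow> nat \<Rightarrow> 'x item set \<Rightarrow> 'x item set" where
  "ella_Predict G k I = I \<union> {((M, w), 0, k, k) | M w L a b i.
     ((L, a @ M # b), length a, i, k) \<in> I \<and> M \<in> cfg_nonterms G \<and> (M, w) \<in> cfg_rules G}"

definition ella_Complete :: "'x cfg \<Rightarrow> nat \<Rightarrow> 'x item set \<Rightarrow> 'x item set" where
  "ella_Complete G k I = I \<union> {((L, a @ M # b), length a + 1, i, k) | L a M b i j w.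
     ((L, a @ M # b), length a, i, j) \<in> I \<and> M \<in> cfg_nonterms G \<and>
     ((M, w), length w, j, k) \<in> I}"

definition ella_Scan :: "'x cfg \<Rightarrow> ('x \<times> 'c list) set \<Rightarrow> nat \<Rightarrow> 'x item set \<Rightarrow> 'x item set" where
  "ella_Scan G T k I = I \<union> {((L, a @ t # b), length a + 1, i, k + length c) | L a t b i c.
     ((L, a @ t # b), length a, i, k) \<in> I \<and> t \<in> cfg_terms G \<and> (t, c) \<in> T}"

definition ella_pi :: "'x cfg \<Rightarrow> nat \<Rightarrow> ('x \<times> 'c list) set \<Rightarrow> 'x item set \<Rightarrow> 'x item set" where
  "ella_pi G k T = limit (ella_Scan G T k \<circ> ella_Complete G k \<circ> ella_Predict G k)"

end

theory Submission
  imports Defs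
begin

text \<open>The steps of both parsers match one by one. Two facts carry the correspondence. First, a
  parameterized item in front of a symbol \<open>X\<close> determines the superscript of \<open>X\<close> only, and every
  subscript \<open>\<beta>\<close> occurs in some ordinary item above it: continue with arbitrary parameters until
  either the right side is exhausted (type (i)) or some function is undefined (type (ii)). Hence
  ELLA predicts whatever PELLA predicts. Second, an item of type (ii) whose dot has not yet reached
  \<open>\<bottom>\<close> can be advanced in PELLA unless the dot then stands in front of \<open>\<bottom>\<close>, and such items are
  removed by \<open>Norm\<close>. ELLA runs one round behind PELLA, because it starts from \<open>\<top>\<close>.\<close>

section \<open>Parameter chains and right sides\<close>

lemma length_funs [simp]: "length (funs r) = Suc (arity r)"
  by (simp add: funs_def arity_def)

lemma length_body [simp]: "length (body r \<rho> h) = h"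
  by (simp add: body_def)

lemma nth_body [simp]:
  "d < h \<Longrightarrow> body r \<rho> h ! d = Tri (sym r d) (\<rho> ! (2 * d + 1)) (\<rho> ! (2 * d + 2))"
  by (simp add: body_def)

lemma chain_take:
  assumes "\<rho> \<in> chain \<Phi> fs" "n \<le> length fs"
  shows "take (2 * n) \<rho> \<in> chain \<Phi> (take n fs)"
  using assms by (auto simp: chain_def min_def dest: in_set_takeD)

lemma chain_snoc:
  assumes "\<rho> \<in> chain \<Phi> fs" "f (\<rho> @ [\<beta>]) = Some a" "\<beta> \<in> \<Phi>" "a \<in> \<Phi>"
  shows "\<rho> @ [\<beta>, a] \<in> chain \<Phi> (fs @ [f])"
  using assms by (auto simp: chain_def nth_append less_Suc_eq)

lemma chain_single:
  assumes "f [\<alpha>] = Some a" "\<alpha> \<in> \<Phi>" "a \<in> \<Phi>"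
  shows "[\<alpha>, a] \<in> chain \<Phi> [f]"
  using assms by (auto simp: chain_def)

lemma funs_in_params:
  assumes "wf_prule P r" "d \<le> arity r" "(funs r ! d) xs = Some a"
  shows "a \<in> params P"
  using assms ranI[of "funs r ! d" xs a] by (auto simp: wf_prule_def pfuns_def)

section \<open>Ordinary items above a parameterized item\<close>

lemma item_bar_iff:
  "(q, d', i', j') \<in> item_bar P (r, d, i, j, \<rho>) \<longleftrightarrow> d' = d \<and> i' = i \<and> j' = j \<and>
     ((\<exists>\<tau>. rule_i P r \<tau> q \<and> take (2 * (d + 1)) \<tau> = \<rho>) \<or>
      (\<exists>h \<sigma>. rule_ii P r h \<sigma> q \<and> d \<le> h - 1 \<and> take (2 * (d + 1)) \<sigma> = \<rho>))"
  by (cases q) auto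

declare item_bar.simps [simp del]

text \<open>Since \<open>rule_ii\<close> forces \<open>1 \<le> h\<close>, the truncated bound
  \<open>d \<le> h - 1\<close> becomes the strict \<open>d < h\<close>, the form used in all later
  case distinctions.\<close>

lemma item_bar_elim:
  assumes "(q, d', i', j') \<in> item_bar P (r, d, i, j, \<rho>)"
  obtains (i) \<tau> where "d' = d" "i' = i" "j' = j" "rule_i P r \<tau> q" "take (2 * (d + 1)) \<tau> = \<rho>"
  | (ii) h \<sigma> where "d' = d" "i' = i" "j' = j" "rule_ii P r h \<sigma> q" "d < h"
      "take (2 * (d + 1)) \<sigma> = \<rho>"
proof -
  have "d < h" if "rule_ii P r h \<sigma> q" "d \<le> h - 1" for h \<sigma>
    using that by (auto simp: rule_ii_def)
  then show thesis
    using assms that unfolding item_bar_iff by blast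
qed

lemma item_bar_i:
  "rule_i P r \<tau> q \<Longrightarrow> take (2 * (d + 1)) \<tau> = \<rho> \<Longrightarrow>
    (q, d, i, j) \<in> item_bar P (r, d, i, j, \<rho>)"
  unfolding item_bar_iff by blast

lemma item_bar_ii:
  "rule_ii P r h \<sigma> q \<Longrightarrow> d < h \<Longrightarrow> take (2 * (d + 1)) \<sigma> = \<rho> \<Longrightarrow>
    (q, d, i, j) \<in> item_bar P (r, d, i, j, \<rho>)"
  unfolding item_bar_iff by (metis Suc_diff_1 less_Suc_eq_le less_nat_zero_code neq0_conv)

text \<open>The first parameter lies in every prefix, so \<open>\<rho>\<close> fixes the
  superscript. The subscript is the last entry of the full chain in type (i) and free in type (ii),
  hence only known to be some parameter.\<close>

lemma item_bar_lhs:
  assumes "(q, d', i', j') \<in> item_bar P (r, d, i, j, \<rho>)"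
  shows "\<exists>\<beta> \<in> params P. fst q = Tri (lhs r) (\<rho> ! 0) \<beta>"
  using assms
proof (cases rule: item_bar_elim)
  case (i \<tau>)
  then have "\<tau> ! (2 * arity r + 1) \<in> params P"
    by (auto simp: rule_i_def chain_def intro!: subsetD[OF _ nth_mem])
  with i show ?thesis by (auto simp: rule_i_def)
next
  case (ii h \<sigma>)
  then show ?thesis by (auto simp: rule_ii_def)
qed

lemma item_bar_rule:
  assumes "(q, d', i', j') \<in> item_bar P (r, d, i, j, \<rho>)" "r \<in> prules P"
  shows "q \<in> cfg_rules (induced P)"
  using assms(1) by (cases rule: item_bar_elim) (use assms(2) in \<open>auto simp: induced_def rule_bar_def\<close>)

text \<open>A right side of type (i) contains no \<open>Bot\<close>, and in type (ii) the bound
  \<open>d < h\<close> leaves at least one symbol between the dot and \<open>Bot\<close>. So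
  \<open>Norm\<close> removes nothing that comes from a parameterized item.\<close>

lemma item_bar_Norm:
  assumes "((L, w), d', i', j') \<in> item_bar P (r, d, i, j, \<rho>)"
  shows "L \<noteq> Top" "drop d' w \<noteq> [Bot]"
proof -
  show "L \<noteq> Top"
    using item_bar_lhs[OF assms] by auto
  show "drop d' w \<noteq> [Bot]"
    using assms
  proof (cases rule: item_bar_elim)
    case (i \<tau>)
    have "Bot \<notin> set w"
      using i by (auto simp: rule_i_def body_def)
    then show ?thesis
      by (metis in_set_dropD list.set_intros(1))
  next
    case (ii h \<sigma>)
    then have "length (drop d' w) > 1" by (auto simp: rule_ii_def)
    then show ?thesis by (metis One_nat_def length_Cons less_irrefl list.size(3))
  qed
qed

text \<open>For \<open>c < d\<close> both indices are below \<open>2 * (d + 1)\<close>, the length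
  of the prefix \<open>\<rho>\<close>: symbols before the dot are determined completely.\<close>

lemma item_bar_nth:
  assumes "(q, d', i', j') \<in> item_bar P (r, d, i, j, \<rho>)" "c < d" "d \<le> arity r"
  shows "snd q ! c = Tri (sym r c) (\<rho> ! (2 * c + 1)) (\<rho> ! (2 * c + 2)) \<and> c < length (snd q)"
  using assms(1)
proof (cases rule: item_bar_elim)
  case (i \<tau>)
  then show ?thesis using assms(2,3) by (auto simp: rule_i_def)
next
  case (ii h \<sigma>)
  then show ?thesis using assms(2)
    by (auto simp: rule_ii_def nth_append chain_def)
qed

text \<open>Index \<open>2 * d + 1\<close> is the last one inside the prefix and
  \<open>2 * d + 2\<close> the first one outside, so only the superscript is determined. In type
  (ii) the symbol is not \<open>Bot\<close> because \<open>d < h\<close>.\<close>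

lemma item_bar_next:
  assumes "(q, d', i', j') \<in> item_bar P (r, d, i, j, \<rho>)" "d < length (snd q)"
  shows "d < arity r \<and> (\<exists>\<beta>. snd q ! d = Tri (sym r d) (\<rho> ! (2 * d + 1)) \<beta>)"
  using assms(1)
proof (cases rule: item_bar_elim)
  case (i \<tau>)
  then show ?thesis using assms(2) by (auto simp: rule_i_def)
next
  case (ii h \<sigma>)
  then show ?thesis using assms(2)
    by (auto simp: rule_ii_def nth_append chain_def)
qed

text \<open>Type (ii) is impossible, as its right side has length \<open>h + 1 > d\<close>. In type
  (i) the prefix of length \<open>2 * (d + 1)\<close> is the whole chain.\<close>

lemma item_bar_complete:
  assumes "(q, d', i', j') \<in> item_bar P (r, d, i, j, \<rho>)" "d = length (snd q)"
  shows "d = arity r \<and> rule_i P r \<rho> q"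
  using assms(1)
proof (cases rule: item_bar_elim)
  case (i \<tau>)
  then show ?thesis using assms(2) by (auto simp: rule_i_def chain_def)
next
  case (ii h \<sigma>)
  then show ?thesis using assms(2) by (auto simp: rule_ii_def)
qed

section \<open>Moving the dot\<close>

text \<open>The same full parameter sequence serves as witness, with a shorter prefix. The end
  position \<open>j\<close> is free because \<open>item_bar\<close> merely copies positions.\<close>

lemma item_bar_retract:
  assumes "(q, d', i', j') \<in> item_bar P (r, Suc d, i, k, \<rho>)"
  shows "(q, d, i, j) \<in> item_bar P (r, d, i, j, take (2 * (d + 1)) \<rho>)"
  using assms
proof (cases rule: item_bar_elim)
  case (i \<tau>)
  then show ?thesis by (intro item_bar_i[of _ _ \<tau>]) (auto simp: min_def)
next
  case (ii h \<sigma>)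
  then show ?thesis by (intro item_bar_ii[of _ _ h \<sigma>]) (auto simp: min_def)
qed

lemma chain_nth_take:
  assumes "\<tau> \<in> chain \<Phi> fs" "Suc d < length fs"
  shows "(fs ! Suc d) (take (2 * (d + 1)) \<tau> @ [\<tau> ! (2 * d + 2)]) = Some (\<tau> ! (2 * d + 3))"
    and "take (2 * (Suc d + 1)) \<tau> = take (2 * (d + 1)) \<tau> @ [\<tau> ! (2 * d + 2), \<tau> ! (2 * d + 3)]"
proof -
  have len: "2 * d + 3 < length \<tau>" using assms by (auto simp: chain_def)
  have 1: "take (Suc (2 * d + 2)) \<tau> = take (2 * d + 2) \<tau> @ [\<tau> ! (2 * d + 2)]"
    using len by (intro take_Suc_conv_app_nth) auto
  have 2: "take (Suc (2 * d + 3)) \<tau> = take (2 * d + 3) \<tau> @ [\<tau> ! (2 * d + 3)]"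
    using len by (intro take_Suc_conv_app_nth) auto
  show "take (2 * (Suc d + 1)) \<tau> = take (2 * (d + 1)) \<tau> @ [\<tau> ! (2 * d + 2), \<tau> ! (2 * d + 3)]"
    using 1 2 by (simp add: eval_nat_numeral)
  have "(fs ! Suc d) (take (2 * Suc d + 1) \<tau>) = Some (\<tau> ! (2 * Suc d + 1))"
    using assms by (auto simp only: chain_def)
  then show "(fs ! Suc d) (take (2 * (d + 1)) \<tau> @ [\<tau> ! (2 * d + 2)]) = Some (\<tau> ! (2 * d + 3))"
    using 1 by (simp add: eval_nat_numeral)
qed

text \<open>The full sequence behind the item supplies the next function value. In type (ii) this
  requires \<open>Suc d < h\<close>; the last hypothesis guarantees it, since
  \<open>Suc d = h\<close> would put the dot right before \<open>Bot\<close>. That hypothesis is the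
  condition of \<open>Norm\<close> on the advanced item.\<close>

lemma item_bar_advance:
  assumes "(q, d', i', j') \<in> item_bar P (r, d, i, j, \<rho>)" "d < length (snd q)"
    "snd q ! d = Tri X \<alpha> \<beta>" "drop (Suc d) (snd q) \<noteq> [Bot]"
  shows "\<exists>a. (funs r ! (d + 1)) (\<rho> @ [\<beta>]) = Some a \<and>
    (q, Suc d, i, k) \<in> item_bar P (r, Suc d, i, k, \<rho> @ [\<beta>, a])"
  using assms(1)
proof (cases rule: item_bar_elim)
  case (i \<tau>)
  have \<tau>: "\<tau> \<in> chain (params P) (funs r)" and d: "d < arity r" and \<beta>: "\<beta> = \<tau> ! (2 * d + 2)"
    using i assms(2,3) by (auto simp: rule_i_def)
  note step = chain_nth_take[OF \<tau>, of d]
  show ?thesis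
    using step d i \<beta> item_bar_i[OF i(4), of "Suc d" "\<rho> @ [\<beta>, \<tau> ! (2 * d + 3)]" i k] by auto
next
  case (ii h \<sigma>)
  have d: "Suc d < h"
  proof (rule ccontr)
    assume "\<not> Suc d < h"
    with ii(5) have "Suc d = h" by simp
    then have "drop (Suc d) (snd q) = [Bot]"
      using ii by (auto simp: rule_ii_def)
    with assms(4) show False by simp
  qed
  have \<sigma>: "\<sigma> \<in> chain (params P) (take h (funs r))" and h: "h \<le> arity r"
    using ii by (auto simp: rule_ii_def)
  have len: "length \<sigma> = 2 * h" using \<sigma> h by (auto simp: chain_def)
  have \<beta>: "\<beta> = \<sigma> ! (2 * d + 2)"
    using ii d len assms(3) by (auto simp: rule_ii_def nth_append)
  note step = chain_nth_take[OF \<sigma>, of d]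
  show ?thesis
    using step d h ii \<beta> item_bar_ii[OF ii(4) d, of "\<rho> @ [\<beta>, \<sigma> ! (2 * d + 3)]" i k] by auto
qed

text \<open>Induction on the number of symbols after the dot. If the next function is undefined, a
  rule of type (ii) ends here; otherwise the chain grows by one link, and an item above the longer
  chain is retracted.\<close>

lemma item_bar_symbol_exists:
  assumes "params P \<noteq> {}" "wf_prule P r" "d < arity r"
    "\<rho> \<in> chain (params P) (take (d + 1) (funs r))" "\<beta> \<in> params P"
  shows "\<exists>q. (q, d, i, j) \<in> item_bar P (r, d, i, j, \<rho>) \<and> d < length (snd q) \<and>
    snd q ! d = Tri (sym r d) (\<rho> ! (2 * d + 1)) \<beta>"
  using assms(3-5)
proof (induction "arity r - d" arbitrary: d \<rho> \<beta>)
  case 0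
  then show ?case by simp
next
  case (Suc n)
  have len: "length \<rho> = 2 * (d + 1)" using Suc.prems by (auto simp: chain_def)
  show ?case
  proof (cases "(funs r ! Suc d) (\<rho> @ [\<beta>])")
    case None
    \<comment> \<open>The left subscript of a type (ii) rule may be any parameter;
      \<open>\<beta>\<close> is reused for it.\<close>
    define q where "q = (Tri (lhs r) (\<rho> ! 0) \<beta>, body r (\<rho> @ [\<beta>]) (Suc d) @ [Bot])"
    have "rule_ii P r (Suc d) \<rho> q"
      using None Suc.prems by (auto simp: rule_ii_def q_def)
    then have "(q, d, i, j) \<in> item_bar P (r, d, i, j, \<rho>)"
      by (rule item_bar_ii) (auto simp: len)
    moreover have "snd q ! d = Tri (sym r d) (\<rho> ! (2 * d + 1)) \<beta>"
      using len by (auto simp: q_def nth_append)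
    moreover have "d < length (snd q)" by (simp add: q_def)
    ultimately show ?thesis by blast
  next
    case (Some a)
    have a: "a \<in> params P"
      using funs_in_params[OF assms(2) _ Some] Suc.prems(1) by simp
    define \<rho>1 where "\<rho>1 = \<rho> @ [\<beta>, a]"
    have \<rho>1: "\<rho>1 \<in> chain (params P) (take (Suc d + 1) (funs r))"
      using chain_snoc[where f = "funs r ! Suc d", OF Suc.prems(2) Some Suc.prems(3) a] Suc.prems(1)
      by (simp add: \<rho>1_def take_Suc_conv_app_nth)
    obtain q where q: "(q, Suc d, i, j) \<in> item_bar P (r, Suc d, i, j, \<rho>1)"
    proof (cases "Suc d < arity r")
      case True
      \<comment> \<open>The subscript of the following symbol is immaterial, so any parameter will
        do.\<close>
      obtain \<beta>' where "\<beta>' \<in> params P" using assms(1) by auto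
      with Suc.hyps(1)[OF _ True \<rho>1] Suc.hyps(2) that show thesis by fastforce
    next
      case False
      then have *: "Suc d = arity r" using Suc.prems by simp
      define q where "q = (Tri (lhs r) (\<rho>1 ! 0) (\<rho>1 ! (2 * arity r + 1)), body r \<rho>1 (arity r))"
      have "rule_i P r \<rho>1 q"
        using \<rho>1 * by (simp add: rule_i_def q_def)
      moreover have "take (2 * (Suc d + 1)) \<rho>1 = \<rho>1"
        by (simp add: \<rho>1_def len)
      ultimately show thesis using that item_bar_i by blast
    qed
    have "(q, d, i, j) \<in> item_bar P (r, d, i, j, \<rho>)"
      using item_bar_retract[OF q, of j] by (simp add: \<rho>1_def len)
    \<comment> \<open>Seen from position \<open>Suc d\<close>, the symbol at \<open>d\<close> lies
      before the dot, so its subscript is entry \<open>2 * d + 2\<close> of \<open>\<rho>1\<close>,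
      which is \<open>\<beta>\<close>.\<close>
    moreover have "snd q ! d = Tri (sym r d) (\<rho> ! (2 * d + 1)) \<beta> \<and> d < length (snd q)"
      using item_bar_nth[OF q, of d] Suc.prems(1) len by (auto simp: \<rho>1_def nth_append)
    ultimately show ?thesis by blast
  qed
qed

section \<open>Rules of the induced grammar and ELLA steps by index\<close>

text \<open>Both types of rules rest on a non-empty chain (\<open>1 \<le> h\<close> in type (ii)),
  whose first link says that the first function is defined at \<open>\<alpha>\<close>. Hence
  whatever ELLA predicts for a triple, PELLA can predict too.\<close>

lemma induced_rule_Tri:
  assumes "(Tri N \<alpha> \<beta>, w) \<in> cfg_rules (induced P)"
  shows "\<exists>r a. r \<in> prules P \<and> lhs r = N \<and> (funs r ! 0) [\<alpha>] = Some a \<and>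
    (\<forall>i j. ((Tri N \<alpha> \<beta>, w), 0, i, j) \<in> item_bar P (r, 0, i, j, [\<alpha>, a]))"
proof -
  have first: "take 2 \<tau> = [\<tau> ! 0, \<tau> ! 1] \<and> (fs ! 0) [\<tau> ! 0] = Some (\<tau> ! 1)"
    if "\<tau> \<in> chain (params P) fs" "0 < length fs" for \<tau> fs
  proof -
    have "length \<tau> = 2 * length fs"
      using that(1) by (simp add: chain_def)
    with that(2) have "2 \<le> length \<tau>"
      by linarith
    then obtain x y zs where "\<tau> = x # y # zs"
      by (metis Suc_le_length_iff numeral_2_eq_2)
    moreover have "(fs ! 0) (take (2 * 0 + 1) \<tau>) = Some (\<tau> ! (2 * 0 + 1))"
      using that by (auto simp only: chain_def)
    ultimately show ?thesis by simp
  qed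
  obtain r where r: "r \<in> prules P" "(Tri N \<alpha> \<beta>, w) \<in> rule_bar P r"
    using assms by (auto simp: induced_def)
  from r(2) consider (i) \<tau> where "rule_i P r \<tau> (Tri N \<alpha> \<beta>, w)"
    | (ii) h \<sigma> where "rule_ii P r h \<sigma> (Tri N \<alpha> \<beta>, w)"
    by (auto simp: rule_bar_def)
  then show ?thesis
  proof cases
    case i
    then have "\<tau> \<in> chain (params P) (funs r)" "lhs r = N" "\<alpha> = \<tau> ! 0"
      by (auto simp: rule_i_def)
    then show ?thesis
      using first[of \<tau> "funs r"] item_bar_i[OF i, of 0] r(1) by auto
  next
    case ii
    then have "\<sigma> \<in> chain (params P) (take h (funs r))" "lhs r = N" "\<alpha> = \<sigma> ! 0" "0 < h"
      by (auto simp: rule_ii_def)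
    then show ?thesis
      using first[of \<sigma> "take h (funs r)"] item_bar_ii[OF ii, of 0] r(1) by auto
  qed
qed

text \<open>In particular no rule has left side \<open>Bot\<close>, so ELLA never moves a dot over
  \<open>Bot\<close> by completion.\<close>

lemma cfg_rules_induced_cases:
  assumes "(L, w) \<in> cfg_rules (induced P)"
  obtains (Top) \<beta> where "L = Top" "w = [Tri (pstart P) (phi_start P) \<beta>]"
  | (Tri) N \<alpha> \<beta> where "L = Tri N \<alpha> \<beta>"
  using assms by (auto simp: induced_def rule_bar_def rule_i_def rule_ii_def)

lemma cfg_start_induced [simp]: "cfg_start (induced P) = Top"
  by (simp add: induced_def)

lemma Tri_in_cfg_nonterms_induced:
  "Tri N \<alpha> \<beta> \<in> cfg_nonterms (induced P) \<longleftrightarrow>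
    N \<in> nonterms P \<and> \<alpha> \<in> params P \<and> \<beta> \<in> params P"
  by (auto simp: induced_def)

lemma Norm_iff:
  "((L, w), d, i, j) \<in> Norm I \<longleftrightarrow> ((L, w), d, i, j) \<in> I \<and> L \<noteq> Top \<and> drop d w \<noteq> [Bot]"
  by (auto simp: Norm_def)

lemma items_bar_mono: "I \<subseteq> J \<Longrightarrow> items_bar P I \<subseteq> items_bar P J"
  by (auto simp: items_bar_def)

lemma Norm_items_bar: "items_bar P I \<subseteq> I' \<Longrightarrow> items_bar P I \<subseteq> Norm I'"
  unfolding items_bar_def using item_bar_Norm by (fastforce simp: Norm_iff)

text \<open>Replaces the split \<open>a @ M # b\<close> of the definition by an index, which is how
  the facts on \<open>item_bar\<close> describe the symbol after the dot.\<close>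

lemma ella_PredictI:
  assumes "((L, v), d, i, k) \<in> I" "d < length v" "v ! d = M" "M \<in> cfg_nonterms G"
    "(M, w) \<in> cfg_rules G"
  shows "((M, w), 0, k, k) \<in> ella_Predict G k I"
proof -
  have "((L, take d v @ M # drop (Suc d) v), length (take d v), i, k) \<in> I"
    using assms(1-3) id_take_nth_drop[OF assms(2)] by simp
  then show ?thesis
    using assms(4,5) unfolding ella_Predict_def by blast
qed

lemma ella_CompleteI:
  assumes "((L, v), d, i, j) \<in> I" "d < length v" "v ! d = M" "M \<in> cfg_nonterms G"
    "((M, w), length w, j, k) \<in> I"
  shows "((L, v), Suc d, i, k) \<in> ella_Complete G k I"
proof -
  have v: "v = take d v @ M # drop (Suc d) v"
    using assms(3) id_take_nth_drop[OF assms(2)] by simp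
  then have "((L, take d v @ M # drop (Suc d) v), length (take d v), i, j) \<in> I"
    using assms(1,2) by simp
  then have "((L, take d v @ M # drop (Suc d) v), length (take d v) + 1, i, k) \<in> ella_Complete G k I"
    using assms(4,5) unfolding ella_Complete_def by blast
  then show ?thesis using v assms(2) by simp
qed

section \<open>Both parsers stay within well-formed items\<close>

lemma items_iff:
  "(q, d, i, j) \<in> items G D \<longleftrightarrow>
    q \<in> cfg_rules G \<and> d \<le> length (snd q) \<and> i \<le> j \<and> j \<le> length D"
  by (simp add: items_def)

lemma ella_Init_items: "ella_Init G \<subseteq> items G D"
  by (auto simp: ella_Init_def items_iff)

lemma ella_Predict_items:
  assumes "k \<le> length D" "I \<subseteq> items G D"
  shows "ella_Predict G k I \<subseteq> items G D"
  using assms by (auto simp: ella_Predict_def items_iff)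

lemma ella_Complete_items:
  assumes "k \<le> length D" "I \<subseteq> items G D"
  shows "ella_Complete G k I \<subseteq> items G D"
proof
  fix x assume "x \<in> ella_Complete G k I"
  then consider "x \<in> I" | L a M b i j w where "x = ((L, a @ M # b), length a + 1, i, k)"
      "((L, a @ M # b), length a, i, j) \<in> I" "((M, w), length w, j, k) \<in> I"
    unfolding ella_Complete_def by blast
  then show "x \<in> items G D"
  proof cases
    case 2
    have "((L, a @ M # b), length a, i, j) \<in> items G D" "((M, w), length w, j, k) \<in> items G D"
      using 2 assms(2) by auto
    then show ?thesis
      using 2(1) by (simp add: items_iff)
  qed (use assms in auto)
qed

context
  fixes P :: "('f, 's, 'c, 'lex, 'sel) pll"
  assumes P: "parameterized_local_lexing P"
begin

lemma wf_rule: "r \<in> prules P \<Longrightarrow> wf_prule P r"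
  using P by (auto simp: parameterized_local_lexing_def)

lemma lhs_nonterms: "r \<in> prules P \<Longrightarrow> lhs r \<in> nonterms P"
  using wf_rule by (auto simp: wf_prule_def)

lemma pitem_params:
  assumes "(r, d, i, j, \<rho>) \<in> pitems P D" "n \<le> 2 * d + 1"
  shows "\<rho> ! n \<in> params P"
  using assms by (auto simp: pitems_def chain_def intro!: subsetD[OF _ nth_mem])

lemma pella_Init_pitems: "pella_Init P \<subseteq> pitems P D"
proof
  fix x assume "x \<in> pella_Init P"
  then obtain r a where x: "x = (r, 0, 0, 0, [phi_start P, a])" and r: "r \<in> prules P"
    and a: "(funs r ! 0) [phi_start P] = Some a"
    by (auto simp: pella_Init_def)
  have "[phi_start P, a] \<in> chain (params P) [funs r ! 0]"
    using P a funs_in_params[OF wf_rule[OF r] _ a]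
    by (intro chain_single) (auto simp: parameterized_local_lexing_def)
  then show "x \<in> pitems P D"
    using x r by (auto simp: pitems_def take_Suc_conv_app_nth)
qed

lemma pella_Predict_pitems:
  assumes "I \<subseteq> pitems P D" "k \<le> length D"
  shows "pella_Predict P k I \<subseteq> pitems P D"
proof
  fix x assume "x \<in> pella_Predict P k I"
  then consider "x \<in> I" | r' a r d i \<rho> where "x = (r', 0, k, k, [\<rho> ! (2 * d + 1), a])"
      "(r, d, i, k, \<rho>) \<in> I" "r' \<in> prules P" "(funs r' ! 0) [\<rho> ! (2 * d + 1)] = Some a"
    unfolding pella_Predict_def by blast
  then show "x \<in> pitems P D"
  proof cases
    case 2
    have "\<rho> ! (2 * d + 1) \<in> params P"
      using pitem_params 2(2) assms(1) by blast
    moreover have "a \<in> params P"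
      using funs_in_params[OF wf_rule[OF 2(3)] _ 2(4)] by simp
    ultimately have "[\<rho> ! (2 * d + 1), a] \<in> chain (params P) [funs r' ! 0]"
      using 2(4) by (intro chain_single)
    then show ?thesis
      using 2 assms(2) by (auto simp: pitems_def take_Suc_conv_app_nth)
  qed (use assms in auto)
qed

lemma pella_Complete_pitems:
  assumes "I \<subseteq> pitems P D" "k \<le> length D"
  shows "pella_Complete P k I \<subseteq> pitems P D"
proof
  fix x assume "x \<in> pella_Complete P k I"
  then consider "x \<in> I" | r d i j \<rho> r' \<xi> a where
      "x = (r, d + 1, i, k, (\<rho> @ [\<xi> ! (2 * arity r' + 1)]) @ [a])"
      "(r, d, i, j, \<rho>) \<in> I" "d < arity r" "(r', arity r', j, k, \<xi>) \<in> I"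
      "(funs r ! (d + 1)) (\<rho> @ [\<xi> ! (2 * arity r' + 1)]) = Some a"
    unfolding pella_Complete_def by blast
  then show "x \<in> pitems P D"
  proof cases
    case 2
    have x: "(r, d, i, j, \<rho>) \<in> pitems P D" and y: "(r', arity r', j, k, \<xi>) \<in> pitems P D"
      using 2 assms(1) by auto
    have r: "r \<in> prules P" using x by (simp add: pitems_def)
    have "a \<in> params P"
      using funs_in_params[OF wf_rule[OF r] _ 2(5)] 2(3) by simp
    then have "\<rho> @ [\<xi> ! (2 * arity r' + 1), a] \<in>
        chain (params P) (take (d + 1) (funs r) @ [funs r ! (d + 1)])"
      using x pitem_params[OF y] 2(5) by (intro chain_snoc) (auto simp: pitems_def)
    then show ?thesis
      using 2 x y by (auto simp: pitems_def take_Suc_conv_app_nth)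
  qed (use assms in auto)
qed

section \<open>From PELLA to ELLA\<close>

text \<open>\<open>ella_Init\<close> holds one item for every subscript of the start symbol, so one
  prediction yields all rules for the start symbol at \<open>phi_start P\<close>. This extra
  prediction is the delay of one round.\<close>

lemma items_bar_pella_Init:
  "items_bar P (pella_Init P) \<subseteq> ella_Predict (induced P) 0 (ella_Init (induced P))"
proof
  fix y assume "y \<in> items_bar P (pella_Init P)"
  then obtain r a L w d i j where r: "r \<in> prules P" "lhs r = pstart P"
    and y: "y = ((L, w), d, i, j)" "y \<in> item_bar P (r, 0, 0, 0, [phi_start P, a])"
    by (cases y) (auto simp: items_bar_def pella_Init_def)
  have [simp]: "d = 0" "i = 0" "j = 0" using y by (auto simp: item_bar_iff)
  obtain \<beta> where \<beta>: "\<beta> \<in> params P" "L = Tri (pstart P) (phi_start P) \<beta>"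
    using item_bar_lhs[OF y(2)[unfolded y(1)]] r(2) by auto
  have "((Top, [L]), 0, 0, 0) \<in> ella_Init (induced P)"
    using \<beta> by (auto simp: ella_Init_def induced_def)
  moreover have "L \<in> cfg_nonterms (induced P)"
    using \<beta> P by (auto simp: Tri_in_cfg_nonterms_induced parameterized_local_lexing_def)
  moreover have "(L, w) \<in> cfg_rules (induced P)"
    using item_bar_rule y r by blast
  ultimately show "y \<in> ella_Predict (induced P) 0 (ella_Init (induced P))"
    unfolding y by simp (rule ella_PredictI, auto)
qed

lemma items_bar_pella_Predict:
  assumes "I \<subseteq> pitems P D" "items_bar P I \<subseteq> I'"
  shows "items_bar P (pella_Predict P k I) \<subseteq> ella_Predict (induced P) k I'"
proof
  fix y assume "y \<in> items_bar P (pella_Predict P k I)"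
  then obtain x where x: "x \<in> pella_Predict P k I" and y: "y \<in> item_bar P x"
    by (auto simp: items_bar_def)
  from x consider "x \<in> I" | r' a r d i \<rho> where "x = (r', 0, k, k, [\<rho> ! (2 * d + 1), a])"
      "(r, d, i, k, \<rho>) \<in> I" "d < arity r" "r' \<in> prules P" "lhs r' = sym r d"
    unfolding pella_Predict_def by blast
  then show "y \<in> ella_Predict (induced P) k I'"
  proof cases
    case 1
    then have "y \<in> I'" using assms y by (auto simp: items_bar_def)
    then show ?thesis by (simp add: ella_Predict_def)
  next
    case 2
    obtain L w d' i' j' where y': "y = ((L, w), d', i', j')" by (metis prod.exhaust)
    note y = y[unfolded y' 2(1)]
    have [simp]: "d' = 0" "i' = k" "j' = k"
      using y by (auto simp: item_bar_iff)
    obtain \<beta> where \<beta>: "\<beta> \<in> params P" "L = Tri (sym r d) (\<rho> ! (2 * d + 1)) \<beta>"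
      using item_bar_lhs[OF y] 2(5) by auto
    have I: "(r, d, i, k, \<rho>) \<in> pitems P D" using 2 assms by auto
    \<comment> \<open>The subscript \<open>\<beta>\<close> of the predicted left side is arbitrary,
      so an item above \<open>\<rho>\<close> with exactly this symbol after the dot has to be
      constructed.\<close>
    obtain q where q: "(q, d, i, k) \<in> item_bar P (r, d, i, k, \<rho>)" "d < length (snd q)" "snd q ! d = L"
      using item_bar_symbol_exists[of P r d \<rho> \<beta> i k] P I 2(3) \<beta>
      unfolding parameterized_local_lexing_def pitems_def by blast
    have "((fst q, snd q), d, i, k) \<in> I'"
      using q(1) 2(2) assms(2) by (auto simp: items_bar_def)
    moreover have "L \<in> cfg_nonterms (induced P)"
      using \<beta> pitem_params[OF I] lhs_nonterms[OF 2(4)] 2(5) by (simp add: Tri_in_cfg_nonterms_induced)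
    ultimately show ?thesis
      unfolding y' using ella_PredictI[OF _ q(2,3), of "fst q" i k I'] item_bar_rule[OF y 2(4)] by simp
  qed
qed

text \<open>Read backwards: an item above the advanced one retracts to an item above the old one,
  and the symbol just passed is the left side of the rule that \<open>\<xi>\<close> yields.\<close>

lemma items_bar_pella_Complete:
  assumes "I \<subseteq> pitems P D" "items_bar P I \<subseteq> I'"
  shows "items_bar P (pella_Complete P k I) \<subseteq> ella_Complete (induced P) k I'"
proof
  fix y assume "y \<in> items_bar P (pella_Complete P k I)"
  then obtain x where x: "x \<in> pella_Complete P k I" and y: "y \<in> item_bar P x"
    by (auto simp: items_bar_def)
  from x consider "x \<in> I" | r d i j \<rho> r' \<xi> a where
      "x = (r, Suc d, i, k, \<rho> @ [\<xi> ! (2 * arity r' + 1), a])"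
      "(r, d, i, j, \<rho>) \<in> I" "d < arity r" "(r', arity r', j, k, \<xi>) \<in> I"
      "lhs r' = sym r d" "\<rho> ! (2 * d + 1) = \<xi> ! 0"
    unfolding pella_Complete_def by auto
  then show "y \<in> ella_Complete (induced P) k I'"
  proof cases
    case 1
    then have "y \<in> I'" using assms y by (auto simp: items_bar_def)
    then show ?thesis by (simp add: ella_Complete_def)
  next
    case 2
    obtain L w d' i' j' where y': "y = ((L, w), d', i', j')" by (metis prod.exhaust)
    note y = y[unfolded y' 2(1)]
    have [simp]: "d' = Suc d" "i' = i" "j' = k"
      using y by (auto simp: item_bar_iff)
    have X: "(r, d, i, j, \<rho>) \<in> pitems P D" and \<Xi>: "(r', arity r', j, k, \<xi>) \<in> pitems P D"
      using 2 assms(1) by auto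
    have len: "length \<rho> = 2 * (d + 1)" using X by (auto simp: pitems_def chain_def)
    have \<xi>: "\<xi> \<in> chain (params P) (funs r')" using \<Xi> by (auto simp: pitems_def)
    define M where "M = Tri (lhs r') (\<xi> ! 0) (\<xi> ! (2 * arity r' + 1))"
    have w: "w ! d = M" "d < length w"
      using item_bar_nth[OF y, of d] 2 len by (auto simp: nth_append M_def)
    have "((L, w), d, i, j) \<in> item_bar P (r, d, i, j, \<rho>)"
      using item_bar_retract[OF y, of j] len by simp
    then have "((L, w), d, i, j) \<in> I'"
      using 2(2) assms(2) by (auto simp: items_bar_def)
    \<comment> \<open>With the dot at the end, \<open>\<xi>\<close> is a full chain and hence itself
      the parameter sequence of a type (i) rule.\<close>
    moreover have "((M, body r' \<xi> (arity r')), arity r', j, k) \<in> item_bar P (r', arity r', j, k, \<xi>)"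
      using \<xi> by (intro item_bar_i[of _ _ \<xi>]) (auto simp: M_def rule_i_def chain_def)
    then have "((M, body r' \<xi> (arity r')), length (body r' \<xi> (arity r')), j, k) \<in> I'"
      using 2(4) assms(2) by (auto simp: items_bar_def)
    moreover have "M \<in> cfg_nonterms (induced P)"
      using pitem_params[OF \<Xi>] \<Xi>
      by (auto simp: M_def Tri_in_cfg_nonterms_induced pitems_def intro: lhs_nonterms)
    ultimately show ?thesis
      unfolding y' using ella_CompleteI[OF _ w(2,1), of L i j I' "induced P" "body r' \<xi> (arity r')" k]
      by simp
  qed
qed

section \<open>From ELLA to PELLA\<close>

text \<open>The position is 0 here because the items with left side \<open>\<top>\<close> predict at position \<open>k\<close> exactly
  what \<open>pella_Init\<close> contains for \<open>k = 0\<close>.\<close>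

lemma Norm_ella_Predict:
  assumes "I' \<subseteq> items (induced P) D" "Norm I' \<subseteq> items_bar P I" "pella_Init P \<subseteq> I"
  shows "Norm (ella_Predict (induced P) 0 I') \<subseteq> items_bar P (pella_Predict P 0 I)"
proof
  fix y assume y: "y \<in> Norm (ella_Predict (induced P) 0 I')"
  then consider "y \<in> Norm I'" | M w L a b i where "y = ((M, w), 0, 0, 0)"
      "((L, a @ M # b), length a, i, 0) \<in> I'" "(M, w) \<in> cfg_rules (induced P)" "M \<noteq> Top"
    unfolding ella_Predict_def Norm_def by fastforce
  then show "y \<in> items_bar P (pella_Predict P 0 I)"
  proof cases
    case 1
    then show ?thesis
      using assms(2) items_bar_mono[of I "pella_Predict P 0 I"] by (auto simp: pella_Predict_def)
  next
    case 2
    obtain N \<alpha> \<beta> where M: "M = Tri N \<alpha> \<beta>"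
      using 2(3,4) by (auto elim: cfg_rules_induced_cases)
    obtain r' c where r': "r' \<in> prules P" "lhs r' = N" "(funs r' ! 0) [\<alpha>] = Some c"
      "((M, w), 0, 0, 0) \<in> item_bar P (r', 0, 0, 0, [\<alpha>, c])"
      using induced_rule_Tri[OF 2(3)[unfolded M]] M by auto
    have "(r', 0, 0, 0, [\<alpha>, c]) \<in> pella_Predict P 0 I"
    \<comment> \<open>\<open>Norm\<close> discards items with left side \<open>Top\<close>, so no
      item of \<open>I\<close> accounts for them; their predictions are covered by
      \<open>pella_Init P \<subseteq> I\<close>.\<close>
    proof (cases "L = Top")
      case True
      have "(L, a @ M # b) \<in> cfg_rules (induced P)"
        using 2(2) assms(1) by (auto simp: items_def)
      then have "N = pstart P" "\<alpha> = phi_start P"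
        using True by (auto elim!: cfg_rules_induced_cases simp: M append_eq_Cons_conv)
      then have "(r', 0, 0, 0, [\<alpha>, c]) \<in> pella_Init P"
        using r' by (auto simp: pella_Init_def)
      then show ?thesis using assms(3) by (auto simp: pella_Predict_def)
    next
      case False
      then have "((L, a @ M # b), length a, i, 0) \<in> Norm I'"
        using 2(2) by (auto simp: Norm_iff M)
      then obtain r d i' j' \<rho> where I: "(r, d, i', j', \<rho>) \<in> I"
        and x: "((L, a @ M # b), length a, i, 0) \<in> item_bar P (r, d, i', j', \<rho>)"
        using assms(2) by (fastforce simp: items_bar_def)
      have [simp]: "d = length a" "j' = 0"
        using x by (auto simp: item_bar_iff)
      have "d < arity r" "sym r d = N" "\<rho> ! (2 * d + 1) = \<alpha>"
        using item_bar_next[OF x] by (auto simp: M)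
      then show ?thesis
        using I r' unfolding pella_Predict_def by auto
    qed
    then show ?thesis
      unfolding 2(1) items_bar_def using r'(4) by blast
  qed
qed

text \<open>Both premises of the completion must survive \<open>Norm\<close> to have counterparts in
  \<open>I\<close>: \<open>M\<close> heads a rule, so it is not \<open>Bot\<close>; then it is a
  triple, so it is not \<open>Top\<close>, and nothing follows the dot in the completed item. That
  the result survives \<open>Norm\<close> allows the advance in PELLA.\<close>

lemma Norm_ella_Complete:
  assumes "I' \<subseteq> items (induced P) D" "Norm I' \<subseteq> items_bar P I"
  shows "Norm (ella_Complete (induced P) k I') \<subseteq> items_bar P (pella_Complete P k I)"
proof
  fix y assume y: "y \<in> Norm (ella_Complete (induced P) k I')"
  then consider "y \<in> Norm I'" | L a M b i j w where
      "y = ((L, a @ M # b), Suc (length a), i, k)"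
      "((L, a @ M # b), length a, i, j) \<in> I'" "((M, w), length w, j, k) \<in> I'"
      "L \<noteq> Top" "b \<noteq> [Bot]"
    unfolding ella_Complete_def Norm_def by fastforce
  then show "y \<in> items_bar P (pella_Complete P k I)"
  proof cases
    case 1
    then show ?thesis
      using assms(2) items_bar_mono[of I "pella_Complete P k I"] by (auto simp: pella_Complete_def)
  next
    case 2
    have Lrule: "(L, a @ M # b) \<in> cfg_rules (induced P)" and Mrule: "(M, w) \<in> cfg_rules (induced P)"
      using 2 assms(1) by (auto simp: items_def)
    have MBot: "M \<noteq> Bot" using Mrule by (auto elim: cfg_rules_induced_cases)
    have "((L, a @ M # b), length a, i, j) \<in> Norm I'"
      using 2 MBot by (auto simp: Norm_iff)
    then obtain r d i1 j1 \<rho> where I: "(r, d, i1, j1, \<rho>) \<in> I"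
      and "((L, a @ M # b), length a, i, j) \<in> item_bar P (r, d, i1, j1, \<rho>)"
      using assms(2) by (fastforce simp: items_bar_def)
    moreover from this have [simp]: "d = length a" "i1 = i" "j1 = j"
      by (auto simp: item_bar_iff)
    ultimately have x: "((L, a @ M # b), length a, i, j) \<in> item_bar P (r, d, i, j, \<rho>)" by simp
    obtain \<beta> where d: "d < arity r" and M: "M = Tri (sym r d) (\<rho> ! (2 * d + 1)) \<beta>"
      using item_bar_next[OF x] by auto
    have "((M, w), length w, j, k) \<in> Norm I'"
      using 2 M by (auto simp: Norm_iff)
    then obtain r' d' i2 j2 \<xi> where I': "(r', d', i2, j2, \<xi>) \<in> I"
      and x': "((M, w), length w, j, k) \<in> item_bar P (r', d', i2, j2, \<xi>)"
      using assms(2) by (fastforce simp: items_bar_def)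
    have [simp]: "d' = length w" "i2 = j" "j2 = k"
      using x' by (auto simp: item_bar_iff)
    have "d' = arity r'" and "rule_i P r' \<xi> (M, w)"
      using item_bar_complete[OF x'] by auto
    then have r': "(r', arity r', j, k, \<xi>) \<in> I" "lhs r' = sym r d" "\<rho> ! (2 * d + 1) = \<xi> ! 0"
      "\<beta> = \<xi> ! (2 * arity r' + 1)"
      using I' M by (auto simp: rule_i_def)
    obtain c where c: "(funs r ! (d + 1)) (\<rho> @ [\<beta>]) = Some c"
      and z: "((L, a @ M # b), Suc d, i, k) \<in> item_bar P (r, Suc d, i, k, \<rho> @ [\<beta>, c])"
      using item_bar_advance[OF x, where X = "sym r d" and \<alpha> = "\<rho> ! (2 * d + 1)" and \<beta> = \<beta> and k = k]
        2(5) by (auto simp: M)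
    have "(r, d + 1, i, k, (\<rho> @ [\<beta>]) @ [c]) \<in> pella_Complete P k I"
      using I d r' c unfolding pella_Complete_def by auto
    then show ?thesis
      unfolding 2(1) items_bar_def using z by auto
  qed
qed

end

section \<open>Rounds of both parsers and passage to the limit\<close>

theorem theorem15:
  fixes P :: "('f, 's, 'c, 'lex, 'sel) pll" and D :: "'c list"
  assumes "parameterized_local_lexing P"
    and "D \<in> lists (chars P)"
  shows "sim P D
    (pella_pi P 0 {} (pella_Init P))
    (ella_pi (induced P) 0 ({} :: (('s, 'f) isym \<times> 'c list) set) (ella_Init (induced P)))"
proof -
  let ?F = "pella_Scan P {} 0 \<circ> pella_Complete P 0 \<circ> pella_Predict P 0"
  let ?F' = "ella_Scan (induced P) ({} :: (('s, 'f) isym \<times> 'c list) set) 0 \<circ>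
    ella_Complete (induced P) 0 \<circ> ella_Predict (induced P) 0"
  define I where "I n = (?F ^^ n) (pella_Init P)" for n
  define I' where "I' n = (?F' ^^ n) (ella_Init (induced P))" for n
  \<comment> \<open>Without tokens, scanning is the identity.\<close>
  have I_Suc: "I (Suc n) = pella_Complete P 0 (pella_Predict P 0 (I n))" for n
    by (simp add: I_def pella_Scan_def)
  have I'_Suc: "I' (Suc n) = ella_Complete (induced P) 0 (ella_Predict (induced P) 0 (I' n))" for n
    by (simp add: I'_def ella_Scan_def)
  note P = assms(1)
  have pitems: "I n \<subseteq> pitems P D" for n
    by (induction n) (simp_all add: I_Suc pella_Complete_pitems[OF P] pella_Predict_pitems[OF P],
      simp add: I_def pella_Init_pitems[OF P])
  have items: "I' n \<subseteq> items (induced P) D" for n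
    by (induction n) (simp_all add: I'_Suc ella_Complete_items ella_Predict_items,
      simp add: I'_def ella_Init_items)
  have Init: "pella_Init P \<subseteq> I n" for n
    by (induction n) (auto simp: I_Suc pella_Complete_def pella_Predict_def, simp add: I_def)
  \<comment> \<open>The shift to \<open>Suc n\<close> is the delay of ELLA; it disappears in the
    union over all rounds.\<close>
  have sub: "items_bar P (I n) \<subseteq> I' (Suc n)" for n
  proof (induction n)
    case 0
    show ?case
      using items_bar_pella_Init[OF P] unfolding I'_Suc by (auto simp: ella_Complete_def I_def I'_def)
  next
    case (Suc n)
    show ?case
      unfolding I_Suc I'_Suc[of "Suc n"]
      by (intro items_bar_pella_Complete[OF P, of _ D] items_bar_pella_Predict[OF P, of _ D]
          pella_Predict_pitems[OF P] pitems Suc) simp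
  qed
  \<comment> \<open>No shift in this direction: \<open>Norm\<close> empties round 0, where every
    left side is \<open>Top\<close>.\<close>
  have sup: "Norm (I' n) \<subseteq> items_bar P (I n)" for n
  proof (induction n)
    case 0
    show ?case by (auto simp: I'_def ella_Init_def Norm_def)
  next
    case (Suc n)
    show ?case
      unfolding I_Suc I'_Suc
      by (intro Norm_ella_Complete[OF P, of _ D] Norm_ella_Predict[OF P, of _ D]
          ella_Predict_items items Init Suc) simp
  qed
  have pi: "pella_pi P 0 {} (pella_Init P) = (\<Union>n. I n)"
    by (simp add: pella_pi_def limit_def I_def)
  have pi': "ella_pi (induced P) 0 ({} :: (('s, 'f) isym \<times> 'c list) set) (ella_Init (induced P))
      = (\<Union>n. I' n)"
    by (simp add: ella_pi_def limit_def I'_def)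
  have items_bar: "items_bar P (\<Union>n. I n) = (\<Union>n. items_bar P (I n))"
    by (auto simp: items_bar_def)
  have Norm: "Norm (\<Union>n. I' n) = (\<Union>n. Norm (I' n))"
    by (auto simp: Norm_def)
  have "items_bar P (\<Union>n. I n) = Norm (\<Union>n. I' n)"
    unfolding items_bar
  proof
    \<comment> \<open>Inclusion without \<open>Norm\<close> suffices, because items above
      parameterized items always pass it.\<close>
    have "(\<Union>n. items_bar P (I n)) \<subseteq> (\<Union>n. I' n)"
      using sub by blast
    then show "(\<Union>n. items_bar P (I n)) \<subseteq> Norm (\<Union>n. I' n)"
      unfolding items_bar[symmetric] by (rule Norm_items_bar)
    show "Norm (\<Union>n. I' n) \<subseteq> (\<Union>n. items_bar P (I n))"
      unfolding Norm using sup by (intro UN_mono) auto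
  qed
  moreover have "(\<Union>n. I n) \<subseteq> pitems P D" "(\<Union>n. I' n) \<subseteq> items (induced P) D"
    by (intro UN_least pitems items)+
  ultimately show ?thesis
    unfolding pi pi' sim_def by simp
qed

end
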